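(* Let $(\mathcal{M},\phi,\xi,\eta,g)$ be an $\mathcal{F}_i$-manifold for some $i\in\{1,\dots,11\}$ (an almost paracontact almost paracomplex Riemannian manifold in the basic class $\mathcal{F}_i$). Then the tensors $N^{(1)},N^{(2)},N^{(3)},N^{(4)}$ have the following form in the respective cases. - $i\in\{1,2,4,5,6\}$: $N^{(1)}=0$, $N^{(2)}=0$, $N^{(3)}=0$, $N^{(4)}=0$. - $i=3$: $N^{(1)}(x,y,z)=-2\{F(\phi x,\phi y,\phi z)+F(\phi^2x,\phi^2y,\phi z)\}$, $N^{(2)}=0$, $N^{(3)}=0$, $N^{(4)}=0$. - $i=7$: $N^{(1)}(x,y,z)=4F(x,\phi y,\xi)\eta(z)$, $N^{(2)}(x,y)=-4F(x,y,\xi)$, $N^{(3)}=0$, $N^{(4)}=0$. - $i=8$ and $i=9$: $N^{(1)}(x,y,z)=2\{\eta(x)F(y,\phi z,\xi)-\eta(y)F(x,\phi z,\xi)\}$, $N^{(2)}=0$, $N^{(3)}(x,y)=-2F(x,y,\xi)$, $N^{(4)}=0$. - $i=10$: $N^{(1)}(x,y,z)=-\eta(x)F(\xi,y,\phi z)+\eta(y)F(\xi,x,\phi z)$, $N^{(2)}=0$, $N^{(3)}(x,y)=F(\xi,x,y)$, $N^{(4)}=0$. - $i=11$: $N^{(1)}(x,y,z)=\eta(z)\{\eta(x)\omega(\phi y)-\eta(y)\omega(\phi x)\}$, $N^{(2)}(x,y)=\eta(y)\omega(x)-\eta(x)\omega(y)$, $N^{(3)}(x,y)=\eta(y)\omega(x)$,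 $N^{(4)}(x)=-\omega(\phi x)$.
   Context: Let $n\ge 1$. An almost paracontact almost paracomplex Riemannian manifold $(\mathcal{M},\phi,\xi,\eta,g)$ is a $(2n+1)$-dimensional smooth manifold with a $(1,1)$-tensor field $\phi$, a vector field $\xi$ and a 1-form $\eta$ such that $\phi\xi=0$, $\phi^2=I-\eta\otimes\xi$, $\eta\circ\phi=0$, $\eta(\xi)=1$, $\mathrm{tr}\,\phi=0$, and a Riemannian metric $g$ with $g(\phi x,\phi y)=g(x,y)-\eta(x)\eta(y)$, $g(x,\xi)=\eta(x)$. With $\nabla$ the Levi-Civita connection of $g$, the fundamental tensor is $F(x,y,z)=g((\nabla_x\phi)y,z)$. Nijenhuis tensors: with $[\phi,\phi](x,y)=[\phi x,\phi y]+\phi^2[x,y]-\phi[\phi x,y]-\phi[x,\phi y]$, $d\eta(x,y)=(\nabla_x\eta)y-(\nabla_y\eta)x$ and $\mathfrak{L}$ the Lie derivative, $N^{(1)}(x,y)=[\phi,\phi](x,y)-d\eta(x,y)\xi$, $N^{(2)}(x,y)=(\mathfrak{L}_{\phi x}\eta)(y)-(\mathfrak{L}_{\phi y}\eta)(x)$, $N^{(3)}(x)=(\mathfrak{L}_\xi\phi)(x)$, $N^{(4)}(x)=(\mathfrak{L}_\xi\eta)(x)$; also $N^{(1)}(x,y,z)=g(N^{(1)}(x,y),z)$ and $N^{(3)}(x,y)=g(N^{(3)}(x),y)$. Lee forms: for an orthonormal basis $e_1,\dots,e_{2n}$ of $\ker\eta$ at a point, $\theta(z)=\sum_{i=1}^{2n}F(e_i,e_i,z)$,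 $\theta^*(z)=\sum_{i=1}^{2n}F(e_i,\phi e_i,z)$, $\omega(z)=F(\xi,\xi,z)$. Components of $F$. For a $(0,2)$-tensor $S$ put $[S](x,y,z)=S(x,y)\eta(z)+S(x,z)\eta(y)$; put $b(x,y)=F(\phi^2x,\phi^2y,\xi)$ and $c(x,y)=F(\phi x,\phi y,\xi)$. Then $F_1(x,y,z)=\frac1{2n}\{g(\phi x,\phi y)\theta(\phi^2z)+g(\phi x,\phi z)\theta(\phi^2y)-g(x,\phi y)\theta(\phi z)-g(x,\phi z)\theta(\phi y)\}$; $F_2(x,y,z)=\frac14\{2F(\phi^2x,\phi^2y,\phi^2z)+F(\phi^2y,\phi^2z,\phi^2x)+F(\phi^2z,\phi^2x,\phi^2y)-F(\phi y,\phi z,\phi^2x)-F(\phi z,\phi y,\phi^2x)\}-F_1(x,y,z)$; $F_3(x,y,z)=\frac14\{2F(\phi^2x,\phi^2y,\phi^2z)-F(\phi^2y,\phi^2z,\phi^2x)-F(\phi^2z,\phi^2x,\phi^2y)+F(\phi y,\phi z,\phi^2x)+F(\phi z,\phi y,\phi^2x)\}$; $F_4=\frac{\theta(\xi)}{2n}[S]$ with $S(x,y)=g(\phi x,\phi y)$; $F_5=\frac{\theta^*(\xi)}{2n}[S]$ with $S(x,y)=g(x,\phi y)$; $F_6=\frac14[S]-F_4-F_5$ with $S(x,y)=b(x,y)+b(y,x)+c(x,y)+c(y,x)$; $F_7=\frac14[S]$ with $S(x,y)=b(x,y)-b(y,x)+c(x,y)-c(y,x)$; $F_8=\frac14[S]$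 with $S(x,y)=b(x,y)+b(y,x)-c(x,y)-c(y,x)$; $F_9=\frac14[S]$ with $S(x,y)=b(x,y)-b(y,x)-c(x,y)+c(y,x)$; $F_{10}(x,y,z)=\eta(x)F(\xi,\phi^2y,\phi^2z)$; $F_{11}(x,y,z)=\eta(x)\{\eta(y)\omega(z)+\eta(z)\omega(y)\}$. The manifold is an $\mathcal{F}_i$-manifold (belongs to the basic class $\mathcal{F}_i$) if $F=F_i$. *)

theory Defs
  imports "HOL-Analysis.Analysis" "HOL-Library.Function_Algebras"
begin

section \<open>Functions into a real vector space\<close>

text \<open>
  Together with \<open>Function_Algebras\<close> this makes tangent vectors (functionals on functions)
  and vector fields into real vector spaces under pointwise operations.
\<close>

instantiation "fun" :: (type, real_vector) real_vector
begin

definition scaleR_fun_def: "scaleR c f = (\<lambda>x. scaleR c (f x))"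

instance
  by standard (simp_all add: scaleR_fun_def fun_eq_iff scaleR_add_right scaleR_add_left)

end

text \<open>Trace of a linear endomorphism of a finite-dimensional subspace; it does not depend on
  the chosen basis.\<close>

definition trace_on :: "'v::real_vector set \<Rightarrow> ('v \<Rightarrow> 'v) \<Rightarrow> real" where
  "trace_on V A =
     (let B = (SOME B. B \<subseteq> V \<and> independent B \<and> span B = V)
      in \<Sum>b\<in>B. representation B (A b) b)"


section \<open>Smooth manifolds\<close>

primrec C_k_on :: "nat \<Rightarrow> 'e::real_normed_vector set \<Rightarrow> ('e \<Rightarrow> 'b::real_normed_vector) \<Rightarrow> bool" where
  "C_k_on 0 S f = continuous_on S f"
| "C_k_on (Suc k) S f =
     ((\<forall>x\<in>S. f differentiable (at x)) \<and> (\<forall>v. C_k_on k S (\<lambda>x. frechet_derivative f (at x) v)))"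

definition smooth_on :: "'e::real_normed_vector set \<Rightarrow> ('e \<Rightarrow> 'b::real_normed_vector) \<Rightarrow> bool" where
  "smooth_on S f \<longleftrightarrow> (\<forall>k. C_k_on k S f)"

text \<open>A chart is a pair of its domain and its coordinate map. A manifold is a whole
  (Hausdorff, second countable) type together with an atlas; the atlas need not be maximal.\<close>

type_synonym ('a, 'e) chart = "'a set \<times> ('a \<Rightarrow> 'e)"

definition is_chart :: "('a::topological_space, 'e::euclidean_space) chart \<Rightarrow> bool" where
  "is_chart c \<longleftrightarrow> (case c of (U, \<psi>) \<Rightarrow>
     open U \<and> open (\<psi> ` U) \<and> inj_on \<psi> U \<and> homeomorphism U (\<psi> ` U) \<psi> (inv_into U \<psi>))"

definition smooth_atlas ::
  "('a::{t2_space, second_countable_topology}, 'e::euclidean_space) chart set \<Rightarrow> bool" where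
  "smooth_atlas A \<longleftrightarrow>
     (\<forall>c\<in>A. is_chart c) \<and> (\<Union>c\<in>A. fst c) = UNIV \<and>
     (\<forall>(U, \<psi>)\<in>A. \<forall>(V, \<zeta>)\<in>A. smooth_on (\<psi> ` (U \<inter> V)) (\<zeta> \<circ> inv_into U \<psi>))"

definition smooth_functions ::
  "('a::topological_space, 'e::euclidean_space) chart set \<Rightarrow> ('a \<Rightarrow> real) set" where
  "smooth_functions A = {f. \<forall>(U, \<psi>)\<in>A. smooth_on (\<psi> ` U) (f \<circ> inv_into U \<psi>)}"

text \<open>Tangent vectors are derivations at a point of the algebra of smooth functions. Being
  total functionals they are normalised to vanish on nonsmooth functions, so that equality of
  tangent vectors is equality of HOL functions.\<close>

type_synonym 'a tvec = "('a \<Rightarrow> real) \<Rightarrow> real"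
type_synonym 'a vfield = "'a \<Rightarrow> 'a tvec"

definition tangent_space ::
  "('a::topological_space, 'e::euclidean_space) chart set \<Rightarrow> 'a \<Rightarrow> 'a tvec set" where
  "tangent_space A p = {v.
     (\<forall>f\<in>smooth_functions A. \<forall>h\<in>smooth_functions A.
        v (\<lambda>q. f q + h q) = v f + v h \<and>
        v (\<lambda>q. f q * h q) = f p * v h + v f * h p) \<and>
     (\<forall>f\<in>smooth_functions A. \<forall>c. v (\<lambda>q. c * f q) = c * v f) \<and>
     (\<forall>f. f \<notin> smooth_functions A \<longrightarrow> v f = 0)}"

definition vector_fields ::
  "('a::topological_space, 'e::euclidean_space) chart set \<Rightarrow> 'a vfield set" where
  "vector_fields A = {X.
     (\<forall>p. X p \<in> tangent_space A p) \<and>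
     (\<forall>f\<in>smooth_functions A. (\<lambda>p. X p f) \<in> smooth_functions A)}"

definition deriv_along :: "'a vfield \<Rightarrow> ('a \<Rightarrow> real) \<Rightarrow> 'a \<Rightarrow> real" where
  "deriv_along X f p = X p f"

definition fmult :: "('a \<Rightarrow> real) \<Rightarrow> 'a vfield \<Rightarrow> 'a vfield" where
  "fmult f X = (\<lambda>p. f p *\<^sub>R X p)"

definition lie_bracket :: "'a vfield \<Rightarrow> 'a vfield \<Rightarrow> 'a vfield" where
  "lie_bracket X Y = (\<lambda>p f. deriv_along X (deriv_along Y f) p - deriv_along Y (deriv_along X f) p)"

definition extension ::
  "('a::topological_space, 'e::euclidean_space) chart set \<Rightarrow> 'a \<Rightarrow> 'a tvec \<Rightarrow> 'a vfield" where
  "extension A p v = (SOME X. X \<in> vector_fields A \<and> X p = v)"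


section \<open>Almost paracontact almost paracomplex Riemannian manifolds\<close>

text \<open>Tensors are families of multilinear maps on tangent spaces. The record consists of
  an atlas and \<open>\<phi>\<close>, \<open>\<xi>\<close>, \<open>\<eta>\<close>, \<open>g\<close>.\<close>

record ('a, 'e) apapr =
  atlas :: "('a, 'e) chart set"
  phi :: "'a \<Rightarrow> 'a tvec \<Rightarrow> 'a tvec"
  xi :: "'a vfield"
  eta :: "'a \<Rightarrow> 'a tvec \<Rightarrow> real"
  metr :: "'a \<Rightarrow> 'a tvec \<Rightarrow> 'a tvec \<Rightarrow> real"

abbreviation VF :: "('a::topological_space, 'e::euclidean_space) apapr \<Rightarrow> 'a vfield set" where
  "VF M \<equiv> vector_fields (atlas M)"

abbreviation TS :: "('a::topological_space, 'e::euclidean_space) apapr \<Rightarrow> 'a \<Rightarrow> 'a tvec set" where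
  "TS M \<equiv> tangent_space (atlas M)"

text \<open>The action of the structure tensors on vector fields.\<close>

definition Phi :: "('a, 'e) apapr \<Rightarrow> 'a vfield \<Rightarrow> 'a vfield" where
  "Phi M X = (\<lambda>p. phi M p (X p))"

definition Eta :: "('a, 'e) apapr \<Rightarrow> 'a vfield \<Rightarrow> 'a \<Rightarrow> real" where
  "Eta M X = (\<lambda>p. eta M p (X p))"

definition G :: "('a, 'e) apapr \<Rightarrow> 'a vfield \<Rightarrow> 'a vfield \<Rightarrow> 'a \<Rightarrow> real" where
  "G M X Y = (\<lambda>p. metr M p (X p) (Y p))"

definition endomorphism_field ::
  "('a::topological_space, 'e::euclidean_space) apapr \<Rightarrow> bool" where
  "endomorphism_field M \<longleftrightarrow>
     (\<forall>p. \<forall>u\<in>TS M p. phi M p u \<in> TS M p \<and>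
        (\<forall>v\<in>TS M p. phi M p (u + v) = phi M p u + phi M p v) \<and>
        (\<forall>c. phi M p (c *\<^sub>R u) = c *\<^sub>R phi M p u)) \<and>
     (\<forall>X\<in>VF M. Phi M X \<in> VF M)"

definition one_form ::
  "('a::topological_space, 'e::euclidean_space) apapr \<Rightarrow> bool" where
  "one_form M \<longleftrightarrow>
     (\<forall>p. \<forall>u\<in>TS M p.
        (\<forall>v\<in>TS M p. eta M p (u + v) = eta M p u + eta M p v) \<and>
        (\<forall>c. eta M p (c *\<^sub>R u) = c * eta M p u)) \<and>
     (\<forall>X\<in>VF M. Eta M X \<in> smooth_functions (atlas M))"

definition riemannian_metric ::
  "('a::topological_space, 'e::euclidean_space) apapr \<Rightarrow> bool" where
  "riemannian_metric M \<longleftrightarrow>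
     (\<forall>p. \<forall>u\<in>TS M p. \<forall>v\<in>TS M p.
        metr M p u v = metr M p v u \<and>
        (\<forall>w\<in>TS M p. metr M p (u + v) w = metr M p u w + metr M p v w) \<and>
        (\<forall>c. metr M p (c *\<^sub>R u) v = c * metr M p u v)) \<and>
     (\<forall>p. \<forall>u\<in>TS M p. u \<noteq> 0 \<longrightarrow> metr M p u u > 0) \<and>
     (\<forall>X\<in>VF M. \<forall>Y\<in>VF M. G M X Y \<in> smooth_functions (atlas M))"

definition almost_paracontact_paracomplex_riemannian ::
  "nat \<Rightarrow> ('a::{t2_space, second_countable_topology}, 'e::euclidean_space) apapr \<Rightarrow> bool" where
  "almost_paracontact_paracomplex_riemannian n M \<longleftrightarrow>
     n \<ge> 1 \<and> DIM('e) = 2 * n + 1 \<and> smooth_atlas (atlas M) \<and>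
     endomorphism_field M \<and> xi M \<in> VF M \<and> one_form M \<and> riemannian_metric M \<and>
     (\<forall>p. phi M p (xi M p) = 0 \<and> eta M p (xi M p) = 1 \<and> trace_on (TS M p) (phi M p) = 0 \<and>
        (\<forall>u\<in>TS M p.
           phi M p (phi M p u) = u - eta M p u *\<^sub>R xi M p \<and>
           eta M p (phi M p u) = 0 \<and>
           metr M p u (xi M p) = eta M p u \<and>
           (\<forall>v\<in>TS M p. metr M p (phi M p u) (phi M p v) = metr M p u v - eta M p u * eta M p v)))"

type_synonym 'a connection = "'a vfield \<Rightarrow> 'a vfield \<Rightarrow> 'a vfield"

text \<open>\<open>D X Y\<close> is the covariant derivative of \<open>Y\<close> along \<open>X\<close>; the values of \<open>D\<close> outside the
  smooth vector fields are irrelevant.\<close>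

definition affine_connection ::
  "('a::topological_space, 'e::euclidean_space) apapr \<Rightarrow> 'a connection \<Rightarrow> bool" where
  "affine_connection M D \<longleftrightarrow>
     (\<forall>X\<in>VF M. \<forall>Y\<in>VF M. D X Y \<in> VF M \<and>
        (\<forall>Z\<in>VF M. D (X + Z) Y = D X Y + D Z Y \<and> D X (Y + Z) = D X Y + D X Z) \<and>
        (\<forall>f\<in>smooth_functions (atlas M).
           D (fmult f X) Y = fmult f (D X Y) \<and>
           D X (fmult f Y) = fmult (deriv_along X f) Y + fmult f (D X Y)))"

definition levi_civita ::
  "('a::topological_space, 'e::euclidean_space) apapr \<Rightarrow> 'a connection \<Rightarrow> bool" where
  "levi_civita M D \<longleftrightarrow> affine_connection M D \<and>
     (\<forall>X\<in>VF M. \<forall>Y\<in>VF M. D X Y - D Y X = lie_bracket X Y) \<and>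
     (\<forall>X\<in>VF M. \<forall>Y\<in>VF M. \<forall>Z\<in>VF M.
        deriv_along X (G M Y Z) = G M (D X Y) Z + G M Y (D X Z))"


section \<open>The fundamental tensor and the Nijenhuis tensors\<close>

definition F :: "('a, 'e) apapr \<Rightarrow> 'a connection \<Rightarrow> 'a vfield \<Rightarrow> 'a vfield \<Rightarrow> 'a vfield \<Rightarrow> 'a \<Rightarrow> real" where
  "F M D X Y Z = G M (D X (Phi M Y) - Phi M (D X Y)) Z"

definition nijenhuis_phi :: "('a, 'e) apapr \<Rightarrow> 'a vfield \<Rightarrow> 'a vfield \<Rightarrow> 'a vfield" where
  "nijenhuis_phi M X Y =
     lie_bracket (Phi M X) (Phi M Y) + Phi M (Phi M (lie_bracket X Y))
       - Phi M (lie_bracket (Phi M X) Y) - Phi M (lie_bracket X (Phi M Y))"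

definition nabla_eta :: "('a, 'e) apapr \<Rightarrow> 'a connection \<Rightarrow> 'a vfield \<Rightarrow> 'a vfield \<Rightarrow> 'a \<Rightarrow> real" where
  "nabla_eta M D X Y = deriv_along X (Eta M Y) - Eta M (D X Y)"

definition d_eta :: "('a, 'e) apapr \<Rightarrow> 'a connection \<Rightarrow> 'a vfield \<Rightarrow> 'a vfield \<Rightarrow> 'a \<Rightarrow> real" where
  "d_eta M D X Y = nabla_eta M D X Y - nabla_eta M D Y X"

text \<open>Lie derivatives of tensor fields are given by the Leibniz rule with respect to
  evaluation on vector fields.\<close>

definition lie_eta :: "('a, 'e) apapr \<Rightarrow> 'a vfield \<Rightarrow> 'a vfield \<Rightarrow> 'a \<Rightarrow> real" where
  "lie_eta M X Y = deriv_along X (Eta M Y) - Eta M (lie_bracket X Y)"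

definition lie_phi :: "('a, 'e) apapr \<Rightarrow> 'a vfield \<Rightarrow> 'a vfield \<Rightarrow> 'a vfield" where
  "lie_phi M X Y = lie_bracket X (Phi M Y) - Phi M (lie_bracket X Y)"

definition N1 :: "('a, 'e) apapr \<Rightarrow> 'a connection \<Rightarrow> 'a vfield \<Rightarrow> 'a vfield \<Rightarrow> 'a vfield" where
  "N1 M D X Y = nijenhuis_phi M X Y - fmult (d_eta M D X Y) (xi M)"

definition N2 :: "('a, 'e) apapr \<Rightarrow> 'a vfield \<Rightarrow> 'a vfield \<Rightarrow> 'a \<Rightarrow> real" where
  "N2 M X Y = lie_eta M (Phi M X) Y - lie_eta M (Phi M Y) X"

definition N3 :: "('a, 'e) apapr \<Rightarrow> 'a vfield \<Rightarrow> 'a vfield" where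
  "N3 M X = lie_phi M (xi M) X"

definition N4 :: "('a, 'e) apapr \<Rightarrow> 'a vfield \<Rightarrow> 'a \<Rightarrow> real" where
  "N4 M X = lie_eta M (xi M) X"


section \<open>Lee forms\<close>

definition lee_basis ::
  "nat \<Rightarrow> ('a::topological_space, 'e::euclidean_space) apapr \<Rightarrow> 'a \<Rightarrow> (nat \<Rightarrow> 'a tvec) \<Rightarrow> bool" where
  "lee_basis n M p e \<longleftrightarrow>
     span (e ` {..<2 * n}) = {v \<in> TS M p. eta M p v = 0} \<and>
     (\<forall>i<2 * n. \<forall>j<2 * n. metr M p (e i) (e j) = (if i = j then 1 else 0))"

text \<open>The sums below are independent of the orthonormal basis, and, \<open>F\<close> being a tensor, of
  the smooth vector fields by which the basis vectors are extended in order to apply \<open>F\<close>.\<close>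

definition theta ::
  "nat \<Rightarrow> ('a::topological_space, 'e::euclidean_space) apapr \<Rightarrow> 'a connection \<Rightarrow> 'a vfield \<Rightarrow> 'a \<Rightarrow> real" where
  "theta n M D Z p =
     (let e = (SOME e. lee_basis n M p e); E = (\<lambda>i. extension (atlas M) p (e i))
      in \<Sum>i<2 * n. F M D (E i) (E i) Z p)"

definition theta_star ::
  "nat \<Rightarrow> ('a::topological_space, 'e::euclidean_space) apapr \<Rightarrow> 'a connection \<Rightarrow> 'a vfield \<Rightarrow> 'a \<Rightarrow> real" where
  "theta_star n M D Z p =
     (let e = (SOME e. lee_basis n M p e); E = (\<lambda>i. extension (atlas M) p (e i))
      in \<Sum>i<2 * n. F M D (E i) (Phi M (E i)) Z p)"

definition omega :: "('a, 'e) apapr \<Rightarrow> 'a connection \<Rightarrow> 'a vfield \<Rightarrow> 'a \<Rightarrow> real" where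
  "omega M D Z = F M D (xi M) (xi M) Z"


section \<open>The components of the fundamental tensor and the basic classes\<close>

definition eta_sym ::
  "('a, 'e) apapr \<Rightarrow> ('a vfield \<Rightarrow> 'a vfield \<Rightarrow> 'a \<Rightarrow> real)
     \<Rightarrow> 'a vfield \<Rightarrow> 'a vfield \<Rightarrow> 'a vfield \<Rightarrow> 'a \<Rightarrow> real" where
  "eta_sym M S X Y Z p = S X Y p * Eta M Z p + S X Z p * Eta M Y p"

definition bF :: "('a, 'e) apapr \<Rightarrow> 'a connection \<Rightarrow> 'a vfield \<Rightarrow> 'a vfield \<Rightarrow> 'a \<Rightarrow> real" where
  "bF M D X Y = F M D (Phi M (Phi M X)) (Phi M (Phi M Y)) (xi M)"

definition cF :: "('a, 'e) apapr \<Rightarrow> 'a connection \<Rightarrow> 'a vfield \<Rightarrow> 'a vfield \<Rightarrow> 'a \<Rightarrow> real" where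
  "cF M D X Y = F M D (Phi M X) (Phi M Y) (xi M)"

definition F1 where
  "F1 n M D X Y Z p = (let \<phi> = Phi M; g = G M; \<theta> = theta n M D in
     1 / (2 * real n) *
       (g (\<phi> X) (\<phi> Y) p * \<theta> (\<phi> (\<phi> Z)) p + g (\<phi> X) (\<phi> Z) p * \<theta> (\<phi> (\<phi> Y)) p
        - g X (\<phi> Y) p * \<theta> (\<phi> Z) p - g X (\<phi> Z) p * \<theta> (\<phi> Y) p))"

definition F2 where
  "F2 n M D X Y Z p = (let \<phi> = Phi M; \<phi>2 = (\<lambda>V. Phi M (Phi M V)) in
     1 / 4 *
       (2 * F M D (\<phi>2 X) (\<phi>2 Y) (\<phi>2 Z) p + F M D (\<phi>2 Y) (\<phi>2 Z) (\<phi>2 X) p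
        + F M D (\<phi>2 Z) (\<phi>2 X) (\<phi>2 Y) p
        - F M D (\<phi> Y) (\<phi> Z) (\<phi>2 X) p - F M D (\<phi> Z) (\<phi> Y) (\<phi>2 X) p)
     - F1 n M D X Y Z p)"

definition F3 where
  "F3 M D X Y Z p = (let \<phi> = Phi M; \<phi>2 = (\<lambda>V. Phi M (Phi M V)) in
     1 / 4 *
       (2 * F M D (\<phi>2 X) (\<phi>2 Y) (\<phi>2 Z) p - F M D (\<phi>2 Y) (\<phi>2 Z) (\<phi>2 X) p
        - F M D (\<phi>2 Z) (\<phi>2 X) (\<phi>2 Y) p
        + F M D (\<phi> Y) (\<phi> Z) (\<phi>2 X) p + F M D (\<phi> Z) (\<phi> Y) (\<phi>2 X) p))"

definition F4 where
  "F4 n M D X Y Z p = theta n M D (xi M) p / (2 * real n) *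
     eta_sym M (\<lambda>U V. G M (Phi M U) (Phi M V)) X Y Z p"

definition F5 where
  "F5 n M D X Y Z p = theta_star n M D (xi M) p / (2 * real n) *
     eta_sym M (\<lambda>U V. G M U (Phi M V)) X Y Z p"

definition F6 where
  "F6 n M D X Y Z p = (let b = bF M D; c = cF M D in
     1 / 4 * eta_sym M (\<lambda>U V. b U V + b V U + c U V + c V U) X Y Z p
     - F4 n M D X Y Z p - F5 n M D X Y Z p)"

definition F7 where
  "F7 M D X Y Z p = (let b = bF M D; c = cF M D in
     1 / 4 * eta_sym M (\<lambda>U V. b U V - b V U + c U V - c V U) X Y Z p)"

definition F8 where
  "F8 M D X Y Z p = (let b = bF M D; c = cF M D in
     1 / 4 * eta_sym M (\<lambda>U V. b U V + b V U - c U V - c V U) X Y Z p)"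

definition F9 where
  "F9 M D X Y Z p = (let b = bF M D; c = cF M D in
     1 / 4 * eta_sym M (\<lambda>U V. b U V - b V U - c U V + c V U) X Y Z p)"

definition F10 where
  "F10 M D X Y Z p = Eta M X p * F M D (xi M) (Phi M (Phi M Y)) (Phi M (Phi M Z)) p"

definition F11 where
  "F11 M D X Y Z p =
     Eta M X p * (Eta M Y p * omega M D Z p + Eta M Z p * omega M D Y p)"

text \<open>Meaningful for \<open>1 \<le> i \<le> 11\<close> only.\<close>

definition F_component ::
  "nat \<Rightarrow> nat \<Rightarrow> ('a::topological_space, 'e::euclidean_space) apapr \<Rightarrow> 'a connection
     \<Rightarrow> 'a vfield \<Rightarrow> 'a vfield \<Rightarrow> 'a vfield \<Rightarrow> 'a \<Rightarrow> real" where
  "F_component i n M D =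
     [F1 n M D, F2 n M D, F3 M D, F4 n M D, F5 n M D, F6 n M D,
      F7 M D, F8 M D, F9 M D, F10 M D, F11 M D] ! (i - 1)"

definition basic_class ::
  "nat \<Rightarrow> nat \<Rightarrow> ('a::topological_space, 'e::euclidean_space) apapr \<Rightarrow> 'a connection \<Rightarrow> bool" where
  "basic_class i n M D \<longleftrightarrow>
     (\<forall>X\<in>VF M. \<forall>Y\<in>VF M. \<forall>Z\<in>VF M. F M D X Y Z = F_component i n M D X Y Z)"

end

theory Submission
  imports Defs
begin

text \<open>
  All four Nijenhuis tensors are linear expressions in the fundamental tensor \<open>F\<close>. Since the
  Levi-Civita connection is torsion free, every bracket in their definitions can be written with
  \<open>\<nabla>\<close>. What remains of \<open>\<nabla>\<close> after cancellation is \<open>\<nabla>\<phi>\<close>, that is \<open>F\<close>, together with \<open>\<nabla>\<eta>\<close>,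
  and differentiating \<open>\<phi>\<^sup>2 = I - \<eta> \<otimes> \<xi>\<close> shows that
  \<open>(\<nabla>\<^sub>x\<eta>)(y) = - F(x, \<phi> y, \<xi>)\<close> (lemma \<open>nabla_eta_F\<close>). The resulting expressions are called
  \<open>N1_of T\<close>, ..., \<open>N4_of T\<close> below, for an arbitrary ternary expression \<open>T\<close>; the lemmas \<open>N1_F\<close> to
  \<open>N4_F\<close> state that the Nijenhuis tensors are their values at \<open>T = F\<close>.

  On a manifold of class \<open>F\<^sub>i\<close> one substitutes \<open>T = F\<^sub>i\<close>. Besides linearity and the symmetries
  of the metric this uses that \<open>F\<close> is symmetric in its last two arguments, and that \<open>\<phi>\<close> can be moved
  between these two arguments at the cost of a sign and of terms containing \<open>\<eta>\<close>
  (lemma \<open>F_Phi_switch\<close>). There are three kinds of classes.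

  In the classes 1 to 3 everything happens on \<open>ker \<eta>\<close>. There \<open>F\<^sub>1\<close> and \<open>F\<^sub>1 + F\<^sub>2\<close> are
  annihilated by all four expressions (lemmas \<open>N_of_F1_shape\<close>, \<open>N_of_F12\<close>). Moreover \<open>F\<^sub>3\<close> is the
  horizontal part of \<open>F\<close> minus \<open>F\<^sub>1 + F\<^sub>2\<close>, and its cyclic sum vanishes, which gives the stated
  form of \<open>N\<^sup>(\<^sup>1\<^sup>)\<close>.

  In the classes 4 to 9 one has \<open>F(x,y,z) = S(x,y) \<eta>(z) + S(x,z) \<eta>(y)\<close> where \<open>S(\<cdot>,\<xi>) = 0\<close> and
  \<open>S(\<phi> x, \<phi> y) = s S(x,y)\<close>, \<open>S(y,x) = t S(x,y)\<close> with signs \<open>s\<close> and \<open>t\<close>. A single computation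
  (lemma \<open>N_of_mixed\<close>) expresses the Nijenhuis tensors by \<open>s\<close> and \<open>t\<close>.

  In the classes 10 and 11 the fundamental tensor is a multiple of \<open>\<eta>(x)\<close>, and nearly all terms
  drop out.
\<close>

section \<open>Algebra of smooth functions and vector fields\<close>

text \<open>The derivatives required by \<open>C_k_on\<close> are those of functions on the whole space, so
  openness of the set is what makes the notion depend only on the values there.\<close>

lemma C_k_on_cong:
  assumes "open S" "\<And>x. x \<in> S \<Longrightarrow> f x = g x" "C_k_on k S f"
  shows "C_k_on k S g"
  using assms(2,3)
proof (induction k arbitrary: f g)
  case 0
  then show ?case by (simp cong: continuous_on_cong)
next
  case (Suc k)
  have D: "(g has_derivative frechet_derivative f (at x)) (at x)" if "x \<in> S" for x
    using Suc.prems that \<open>open S\<close>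
    by (metis C_k_on.simps(2) frechet_derivative_works has_derivative_transform_within_open)
  have E: "frechet_derivative f (at x) = frechet_derivative g (at x)" if "x \<in> S" for x
    using frechet_derivative_at[OF D[OF that]] .
  show ?case
    using Suc.IH Suc.prems(2) D E by (auto simp: differentiable_def) (metis (no_types, lifting))
qed

lemma C_k_on_SucD: "C_k_on (Suc k) S f \<Longrightarrow> C_k_on k S f"
proof (induction k arbitrary: f)
  case 0
  then show ?case
    by (auto intro!: continuous_at_imp_continuous_on differentiable_imp_continuous_within)
next
  case (Suc k)
  then show ?case by (metis C_k_on.simps(2))
qed

lemma C_k_on_const: "C_k_on k S (\<lambda>x. c)"
  by (induction k arbitrary: c) (simp_all add: frechet_derivative_const)

lemma C_k_on_add:
  assumes "open S" "C_k_on k S f" "C_k_on k S g"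
  shows "C_k_on k S (\<lambda>x. f x + g x)"
  using assms(2,3)
proof (induction k arbitrary: f g)
  case 0
  then show ?case by (simp add: continuous_on_add)
next
  case (Suc k)
  have "C_k_on k S (\<lambda>x. frechet_derivative (\<lambda>x. f x + g x) (at x) v)" for v
  proof (rule C_k_on_cong[OF \<open>open S\<close>])
    show "C_k_on k S (\<lambda>x. frechet_derivative f (at x) v + frechet_derivative g (at x) v)"
      using Suc by simp
    fix x assume "x \<in> S"
    then have "((\<lambda>x. f x + g x) has_derivative
        (\<lambda>v. frechet_derivative f (at x) v + frechet_derivative g (at x) v)) (at x)"
      using Suc.prems by (auto intro!: has_derivative_add simp: frechet_derivative_works[symmetric])
    from frechet_derivative_at[OF this]
    show "frechet_derivative f (at x) v + frechet_derivative g (at x) v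
        = frechet_derivative (\<lambda>x. f x + g x) (at x) v"
      by (rule fun_cong)
  qed
  then show ?case using Suc.prems by (auto intro: differentiable_add)
qed

text \<open>The derivative of a product is a sum of products of functions which are at least as
  smooth as \<open>C\<^sup>k\<close>, so the induction hypothesis for \<open>k\<close> applies to all of them.\<close>

lemma C_k_on_mult:
  fixes f g :: "'e::real_normed_vector \<Rightarrow> 'b::real_normed_algebra"
  assumes "open S" "C_k_on k S f" "C_k_on k S g"
  shows "C_k_on k S (\<lambda>x. f x * g x)"
  using assms(2,3)
proof (induction k arbitrary: f g)
  case 0
  then show ?case by (simp add: continuous_on_mult)
next
  case (Suc k)
  have "C_k_on k S (\<lambda>x. frechet_derivative (\<lambda>x. f x * g x) (at x) v)" for v
  proof (rule C_k_on_cong[OF \<open>open S\<close>])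
    show "C_k_on k S (\<lambda>x. f x * frechet_derivative g (at x) v + frechet_derivative f (at x) v * g x)"
      using Suc.prems C_k_on_SucD by (auto intro!: C_k_on_add[OF \<open>open S\<close>] Suc.IH)
    fix x assume "x \<in> S"
    then have "((\<lambda>x. f x * g x) has_derivative
        (\<lambda>v. f x * frechet_derivative g (at x) v + frechet_derivative f (at x) v * g x)) (at x)"
      using Suc.prems by (auto intro!: has_derivative_mult simp: frechet_derivative_works[symmetric])
    from frechet_derivative_at[OF this]
    show "f x * frechet_derivative g (at x) v + frechet_derivative f (at x) v * g x
        = frechet_derivative (\<lambda>x. f x * g x) (at x) v"
      by (rule fun_cong)
  qed
  then show ?case using Suc.prems by (auto intro: differentiable_mult)
qed

lemma smooth_functions_const: "(\<lambda>_. c) \<in> smooth_functions A"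
  by (auto simp: smooth_functions_def smooth_on_def o_def C_k_on_const)

lemma smooth_functions_add:
  assumes "smooth_atlas A" "f \<in> smooth_functions A" "h \<in> smooth_functions A"
  shows "(\<lambda>p. f p + h p) \<in> smooth_functions A"
  using assms unfolding smooth_functions_def smooth_on_def smooth_atlas_def is_chart_def o_def
  by (auto intro!: C_k_on_add)

lemma smooth_functions_mult:
  assumes "smooth_atlas A" "f \<in> smooth_functions A" "h \<in> smooth_functions A"
  shows "(\<lambda>p. f p * h p) \<in> smooth_functions A"
  using assms unfolding smooth_functions_def smooth_on_def smooth_atlas_def is_chart_def o_def
  by (auto intro!: C_k_on_mult)

lemma tangent_space_add:
  "u \<in> tangent_space A p \<Longrightarrow> v \<in> tangent_space A p \<Longrightarrow> u + v \<in> tangent_space A p"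
  by (simp add: tangent_space_def algebra_simps)

lemma tangent_space_scaleR: "u \<in> tangent_space A p \<Longrightarrow> c *\<^sub>R u \<in> tangent_space A p"
  by (simp add: tangent_space_def scaleR_fun_def algebra_simps)

lemma tangent_space_diff:
  "u \<in> tangent_space A p \<Longrightarrow> v \<in> tangent_space A p \<Longrightarrow> u - v \<in> tangent_space A p"
  using tangent_space_add[of u A p "(-1) *\<^sub>R v"] tangent_space_scaleR[of v A p "-1"] by simp

lemma vector_fields_add:
  assumes "smooth_atlas A" "X \<in> vector_fields A" "Y \<in> vector_fields A"
  shows "X + Y \<in> vector_fields A"
  using assms by (simp add: vector_fields_def tangent_space_add smooth_functions_add)

lemma vector_fields_fmult:
  assumes "smooth_atlas A" "f \<in> smooth_functions A" "X \<in> vector_fields A"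
  shows "fmult f X \<in> vector_fields A"
  using assms tangent_space_scaleR
  by (fastforce simp: vector_fields_def fmult_def scaleR_fun_def intro: smooth_functions_mult)

lemma vector_fields_diff:
  assumes "smooth_atlas A" "X \<in> vector_fields A" "Y \<in> vector_fields A"
  shows "X - Y \<in> vector_fields A"
proof -
  have "X - Y = X + fmult (\<lambda>_. - 1) Y"
    by (simp add: fun_eq_iff fmult_def scaleR_fun_def)
  then show ?thesis
    using assms by (simp only:) (intro vector_fields_add vector_fields_fmult smooth_functions_const)
qed

section \<open>Structure tensors and connection\<close>

locale apapr_levi_civita =
  fixes n :: nat
    and M :: "('a::{t2_space, second_countable_topology}, 'e::euclidean_space) apapr"
    and D :: "'a connection"
  assumes apapr: "almost_paracontact_paracomplex_riemannian n M"
    and connection: "levi_civita M D"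
begin

abbreviation "\<phi> \<equiv> Phi M"
abbreviation "\<xi> \<equiv> xi M"
abbreviation "\<eta> \<equiv> Eta M"
abbreviation "g \<equiv> G M"
abbreviation "FT \<equiv> F M D"

lemma atlas: "smooth_atlas (atlas M)"
  and xi_VF [simp, intro]: "\<xi> \<in> VF M"
  and Phi_VF [simp, intro]: "X \<in> VF M \<Longrightarrow> \<phi> X \<in> VF M"
  and Eta_smooth: "X \<in> VF M \<Longrightarrow> \<eta> X \<in> smooth_functions (atlas M)"
  and D_VF [simp, intro]: "X \<in> VF M \<Longrightarrow> Y \<in> VF M \<Longrightarrow> D X Y \<in> VF M"
  using apapr connection
  by (auto simp: almost_paracontact_paracomplex_riemannian_def levi_civita_def
      affine_connection_def endomorphism_field_def one_form_def)

lemma VF_TS: "X \<in> VF M \<Longrightarrow> X p \<in> TS M p"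
  by (simp add: vector_fields_def)

lemma VF_diff [simp, intro]: "X \<in> VF M \<Longrightarrow> Y \<in> VF M \<Longrightarrow> X - Y \<in> VF M"
  by (rule vector_fields_diff[OF atlas])

lemma VF_add [simp, intro]: "X \<in> VF M \<Longrightarrow> Y \<in> VF M \<Longrightarrow> X + Y \<in> VF M"
  by (rule vector_fields_add[OF atlas])

lemma VF_fmult [simp, intro]: "f \<in> smooth_functions (atlas M) \<Longrightarrow> X \<in> VF M \<Longrightarrow> fmult f X \<in> VF M"
  by (rule vector_fields_fmult[OF atlas])

lemma bracket: "X \<in> VF M \<Longrightarrow> Y \<in> VF M \<Longrightarrow> lie_bracket X Y = D X Y - D Y X"
  using connection by (simp add: levi_civita_def)

lemma bracket_VF [simp, intro]: "X \<in> VF M \<Longrightarrow> Y \<in> VF M \<Longrightarrow> lie_bracket X Y \<in> VF M"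
  by (simp add: bracket)

lemma zero_VF [simp, intro]: "0 \<in> VF M"
  using VF_diff[OF xi_VF xi_VF] by simp

lemma G_sym: "X \<in> VF M \<Longrightarrow> Y \<in> VF M \<Longrightarrow> g X Y p = g Y X p"
  using apapr
  by (simp add: almost_paracontact_paracomplex_riemannian_def riemannian_metric_def G_def VF_TS)

lemma G_add_left: "X \<in> VF M \<Longrightarrow> Y \<in> VF M \<Longrightarrow> Z \<in> VF M \<Longrightarrow> g (X + Y) Z p = g X Z p + g Y Z p"
  using apapr
  by (simp add: almost_paracontact_paracomplex_riemannian_def riemannian_metric_def G_def VF_TS)

lemma G_fmult_left: "X \<in> VF M \<Longrightarrow> Y \<in> VF M \<Longrightarrow> g (fmult f X) Y p = f p * g X Y p"
  using apapr
  by (simp add: almost_paracontact_paracomplex_riemannian_def riemannian_metric_def G_def VF_TS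
      fmult_def)

lemma G_diff_left:
  assumes "X \<in> VF M" "Y \<in> VF M" "Z \<in> VF M"
  shows "g (X - Y) Z p = g X Z p - g Y Z p"
  using G_add_left[of "X - Y" Y Z p] assms by simp

lemma G_diff_right:
  "X \<in> VF M \<Longrightarrow> Y \<in> VF M \<Longrightarrow> Z \<in> VF M \<Longrightarrow> g Z (X - Y) p = g Z X p - g Z Y p"
  by (simp add: G_sym[of Z] G_diff_left)

lemma G_zero_left [simp]: "X \<in> VF M \<Longrightarrow> g 0 X p = 0"
  using G_diff_left[of X X X p] by simp

lemma G_zero_right [simp]: "X \<in> VF M \<Longrightarrow> g X 0 p = 0"
  by (simp add: G_sym[of X 0])

text \<open>Positive definiteness turns the scalar identities for \<open>g(N(x,y),z)\<close> into the vanishing of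
  the vector fields \<open>N(x,y)\<close>. The field itself serves as the test field \<open>Z\<close>, and for this it has
  to be smooth.\<close>

lemma VF_eq_0I:
  assumes "X \<in> VF M" "\<And>Z p. Z \<in> VF M \<Longrightarrow> g X Z p = 0"
  shows "X = 0"
proof
  fix p
  show "X p = 0 p"
    using apapr assms(2)[OF assms(1), of p] VF_TS[OF assms(1), of p]
    by (fastforce simp: almost_paracontact_paracomplex_riemannian_def riemannian_metric_def G_def)
qed

lemma Phi_xi [simp]: "\<phi> \<xi> = 0"
  using apapr
  by (simp add: almost_paracontact_paracomplex_riemannian_def Phi_def fun_eq_iff)

lemma Phi_diff: "X \<in> VF M \<Longrightarrow> Y \<in> VF M \<Longrightarrow> \<phi> (X - Y) = \<phi> X - \<phi> Y"
proof -
  assume XY: "X \<in> VF M" "Y \<in> VF M"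
  have add: "phi M p (u + v) = phi M p u + phi M p v" if "u \<in> TS M p" "v \<in> TS M p" for p u v
    using apapr that
    by (simp add: almost_paracontact_paracomplex_riemannian_def endomorphism_field_def)
  have "phi M p (X p - Y p) = phi M p (X p) - phi M p (Y p)" for p
    using add[of "X p - Y p" p "Y p"] XY by (simp add: VF_TS tangent_space_diff)
  then show ?thesis
    by (auto simp: Phi_def)
qed

lemma Phi_zero [simp]: "\<phi> 0 = 0"
  using Phi_diff[of \<xi> \<xi>] by simp

lemma Eta_xi [simp]: "\<eta> \<xi> p = 1"
  and Eta_Phi [simp]: "X \<in> VF M \<Longrightarrow> \<eta> (\<phi> X) p = 0"
  and G_xi_right [simp]: "X \<in> VF M \<Longrightarrow> g X \<xi> p = \<eta> X p"
  and G_Phi_Phi: "X \<in> VF M \<Longrightarrow> Y \<in> VF M \<Longrightarrow> g (\<phi> X) (\<phi> Y) p = g X Y p - \<eta> X p * \<eta> Y p"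
  using apapr
  by (simp_all add: almost_paracontact_paracomplex_riemannian_def Phi_def Eta_def G_def VF_TS)

lemma G_xi_left [simp]: "X \<in> VF M \<Longrightarrow> g \<xi> X p = \<eta> X p"
  by (simp add: G_sym[of \<xi>])

lemma Eta_zero [simp]: "\<eta> 0 p = 0"
  using G_xi_right[of 0 p] G_zero_left[of \<xi> p] by simp

lemma Eta_diff: "X \<in> VF M \<Longrightarrow> Y \<in> VF M \<Longrightarrow> \<eta> (X - Y) p = \<eta> X p - \<eta> Y p"
  using G_diff_left[of X Y \<xi> p] by simp

lemma Phi_Phi: "X \<in> VF M \<Longrightarrow> \<phi> (\<phi> X) = X - fmult (\<eta> X) \<xi>"
  using apapr
  by (auto simp: almost_paracontact_paracomplex_riemannian_def Phi_def Eta_def fmult_def VF_TS)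

text \<open>The splitting into the horizontal part \<open>\<phi>\<^sup>2 X\<close> and the vertical part \<open>\<eta>(X) \<xi>\<close>. It is used
  as a sum of smooth vector fields, to which additivity of \<open>\<nabla>\<close> and its Leibniz rule apply.\<close>

lemma horizontal_plus_vertical: "X \<in> VF M \<Longrightarrow> \<phi> (\<phi> X) + fmult (\<eta> X) \<xi> = X"
  by (simp add: Phi_Phi)

lemma Phi_Phi_Phi [simp]: "X \<in> VF M \<Longrightarrow> \<phi> (\<phi> (\<phi> X)) = \<phi> X"
  by (simp add: Phi_Phi[of "\<phi> X"] fun_eq_iff fmult_def)

lemma Phi_self_adjoint: "X \<in> VF M \<Longrightarrow> Y \<in> VF M \<Longrightarrow> g (\<phi> X) Y p = g X (\<phi> Y) p"
  using G_Phi_Phi[of X "\<phi> Y" p]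
  by (simp add: Phi_Phi[of Y] Eta_smooth G_diff_right G_sym[of _ "fmult _ _"] G_fmult_left)

lemma D_add_left: "X \<in> VF M \<Longrightarrow> Z \<in> VF M \<Longrightarrow> Y \<in> VF M \<Longrightarrow> D (X + Z) Y = D X Y + D Z Y"
  and D_add_right: "X \<in> VF M \<Longrightarrow> Y \<in> VF M \<Longrightarrow> Z \<in> VF M \<Longrightarrow> D X (Y + Z) = D X Y + D X Z"
  and D_fmult_right: "X \<in> VF M \<Longrightarrow> Y \<in> VF M \<Longrightarrow> f \<in> smooth_functions (atlas M)
    \<Longrightarrow> D X (fmult f Y) = fmult (deriv_along X f) Y + fmult f (D X Y)"
  using connection by (simp_all add: levi_civita_def affine_connection_def)

lemma deriv_G: "X \<in> VF M \<Longrightarrow> Y \<in> VF M \<Longrightarrow> Z \<in> VF M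
    \<Longrightarrow> deriv_along X (g Y Z) p = g (D X Y) Z p + g Y (D X Z) p"
  using connection by (simp add: levi_civita_def)

lemma deriv_along_smooth:
  "X \<in> VF M \<Longrightarrow> f \<in> smooth_functions (atlas M) \<Longrightarrow> deriv_along X f \<in> smooth_functions (atlas M)"
  by (simp add: vector_fields_def deriv_along_def[abs_def])

lemma D_horizontal_plus_vertical:
  assumes "X \<in> VF M" "Y \<in> VF M"
  shows "D X Y = D X (\<phi> (\<phi> Y)) + (fmult (deriv_along X (\<eta> Y)) \<xi> + fmult (\<eta> Y) (D X \<xi>))"
  using D_add_right[of X "\<phi> (\<phi> Y)" "fmult (\<eta> Y) \<xi>"] assms
  by (simp add: horizontal_plus_vertical Eta_smooth D_fmult_right)

lemma D_zero_left: "X \<in> VF M \<Longrightarrow> D 0 X = 0"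
  using D_add_left[of 0 0 X] by simp

lemma D_zero_right: "X \<in> VF M \<Longrightarrow> D X 0 = 0"
  using D_add_right[of X 0 0] by simp

section \<open>Symmetries of the fundamental tensor\<close>

lemma F_eq:
  "X \<in> VF M \<Longrightarrow> Y \<in> VF M \<Longrightarrow> Z \<in> VF M \<Longrightarrow> FT X Y Z p = g (D X (\<phi> Y)) Z p - g (D X Y) (\<phi> Z) p"
  by (simp add: F_def G_diff_left Phi_self_adjoint)

text \<open>Differentiate the identity \<open>g(\<phi> y, z) = g(y, \<phi> z)\<close> along \<open>x\<close>.\<close>

lemma F_sym:
  assumes "X \<in> VF M" "Y \<in> VF M" "Z \<in> VF M"
  shows "FT X Y Z p = FT X Z Y p"
proof -
  have "g (\<phi> Y) Z = g Y (\<phi> Z)"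
    using assms by (auto simp: Phi_self_adjoint)
  then have "g (D X (\<phi> Y)) Z p + g (\<phi> Y) (D X Z) p = g (D X Y) (\<phi> Z) p + g Y (D X (\<phi> Z)) p"
    using deriv_G[of X "\<phi> Y" Z p] deriv_G[of X Y "\<phi> Z" p] assms by simp
  then show ?thesis
    using assms by (simp add: F_eq G_sym[of Y] G_sym[of "\<phi> Y"])
qed

lemma F_zero_mid [simp]: "X \<in> VF M \<Longrightarrow> Z \<in> VF M \<Longrightarrow> FT X 0 Z p = 0"
  by (simp add: F_eq D_zero_right)

lemma F_zero_right [simp]: "X \<in> VF M \<Longrightarrow> Y \<in> VF M \<Longrightarrow> FT X Y 0 p = 0"
  by (simp add: F_sym[of X Y 0])

lemma F_zero_left [simp]: "Y \<in> VF M \<Longrightarrow> Z \<in> VF M \<Longrightarrow> FT 0 Y Z p = 0"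
  by (simp add: F_eq D_zero_left)

text \<open>Differentiate \<open>\<eta>(y) = g(y, \<xi>)\<close> along \<open>x\<close>.\<close>

lemma nabla_eta_eq:
  assumes "X \<in> VF M" "Y \<in> VF M"
  shows "nabla_eta M D X Y p = g (D X \<xi>) Y p"
proof -
  have "\<eta> Y = g Y \<xi>"
    using assms by auto
  then show ?thesis
    using deriv_G[of X Y \<xi> p] assms by (simp add: nabla_eta_def G_sym[of Y])
qed

text \<open>This is the covariant derivative of \<open>\<phi>\<^sup>2 = I - \<eta> \<otimes> \<xi>\<close>, applied to \<open>y\<close> and paired
  with \<open>z\<close>.\<close>

lemma F_Phi_switch_nabla:
  assumes "X \<in> VF M" "Y \<in> VF M" "Z \<in> VF M"
  shows "FT X (\<phi> Y) Z p + FT X Y (\<phi> Z) p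
    = - nabla_eta M D X Y p * \<eta> Z p - \<eta> Y p * nabla_eta M D X Z p"
proof -
  have "deriv_along X (\<eta> Y) p = nabla_eta M D X Y p + \<eta> (D X Y) p"
    by (simp add: nabla_eta_def)
  moreover have "g (D X Y) Z p = g (D X (\<phi> (\<phi> Y))) Z p
      + (deriv_along X (\<eta> Y) p * \<eta> Z p + \<eta> Y p * g (D X \<xi>) Z p)"
    using assms
    by (subst D_horizontal_plus_vertical)
      (simp_all add: Eta_smooth deriv_along_smooth G_add_left G_fmult_left)
  ultimately have "g (D X Y) Z p = g (D X (\<phi> (\<phi> Y))) Z p
      + (nabla_eta M D X Y p + \<eta> (D X Y) p) * \<eta> Z p + \<eta> Y p * nabla_eta M D X Z p"
    using assms by (simp add: nabla_eta_eq)
  then show ?thesis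
    using assms
    by (simp add: F_eq Phi_self_adjoint[symmetric, of "D X Y"] G_Phi_Phi algebra_simps)
qed

lemma F_xi_xi [simp]: "X \<in> VF M \<Longrightarrow> FT X \<xi> \<xi> p = 0"
  by (simp add: F_eq D_zero_right)

text \<open>Put \<open>y = \<xi>\<close> in the preceding identity. With \<open>z = \<xi>\<close> as well it yields
  \<open>(\<nabla>\<^sub>x\<eta>)(\<xi>) = 0\<close>, which removes the other term on the right-hand side.\<close>

lemma nabla_eta_F:
  assumes "X \<in> VF M" "Y \<in> VF M"
  shows "nabla_eta M D X Y p = - FT X (\<phi> Y) \<xi> p"
proof -
  have "nabla_eta M D X \<xi> p = 0"
    using F_Phi_switch_nabla[of X \<xi> \<xi> p] assms by simp
  then show ?thesis
    using F_Phi_switch_nabla[of X \<xi> Y p] assms F_sym[of X \<xi> "\<phi> Y" p] by simp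
qed

lemma F_Phi_switch:
  assumes "X \<in> VF M" "Y \<in> VF M" "Z \<in> VF M"
  shows "FT X (\<phi> Y) Z p + FT X Y (\<phi> Z) p
    = FT X (\<phi> Y) \<xi> p * \<eta> Z p + \<eta> Y p * FT X (\<phi> Z) \<xi> p"
  using F_Phi_switch_nabla[OF assms, of p] assms by (simp add: nabla_eta_F)

lemma F_split_mid:
  assumes "X \<in> VF M" "Y \<in> VF M" "Z \<in> VF M"
  shows "FT X (\<phi> (\<phi> Y)) Z p = FT X Y Z p - \<eta> Y p * FT X \<xi> Z p"
proof -
  have "g (D X Y) (\<phi> Z) p = g (D X (\<phi> (\<phi> Y))) (\<phi> Z) p + \<eta> Y p * g (D X \<xi>) (\<phi> Z) p"
    using assms
    by (subst D_horizontal_plus_vertical)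
      (simp_all add: Eta_smooth deriv_along_smooth G_add_left G_fmult_left)
  then show ?thesis
    using assms by (simp add: F_eq D_zero_right)
qed

lemma F_PhiPhi_mid_xi [simp]:
  "X \<in> VF M \<Longrightarrow> Y \<in> VF M \<Longrightarrow> FT X (\<phi> (\<phi> Y)) \<xi> p = FT X Y \<xi> p"
  by (simp add: F_split_mid)

text \<open>On horizontal arguments the correction terms with \<open>\<eta>\<close> vanish: \<open>\<nabla>\<^sub>x\<phi>\<close> anticommutes with
  \<open>\<phi>\<close>. In the three forms below every horizontal argument appears as \<open>\<phi> Y\<close> or \<open>\<phi>\<^sup>2 Y\<close>. Used from
  left to right, the first two remove \<open>\<phi>\<^sup>2\<close> from the second slot and thus normalise \<open>F\<close> on
  horizontal fields; the third is the symmetry of \<open>F\<close> expressed in these normal forms.\<close>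

lemma F_Phi_skew:
  assumes "X \<in> VF M" "Y \<in> VF M" "Z \<in> VF M"
  shows "FT X (\<phi> (\<phi> Y)) (\<phi> Z) p = - FT X (\<phi> Y) (\<phi> (\<phi> Z)) p"
  using F_Phi_switch[of X "\<phi> Y" "\<phi> Z" p] assms by simp

lemma F_PhiPhi_PhiPhi:
  assumes "X \<in> VF M" "Y \<in> VF M" "Z \<in> VF M"
  shows "FT X (\<phi> (\<phi> Y)) (\<phi> (\<phi> Z)) p = - FT X (\<phi> Y) (\<phi> Z) p"
  using F_Phi_switch[of X "\<phi> Y" "\<phi> (\<phi> Z)" p] assms by simp

lemma F_Phi_PhiPhi_alt:
  assumes "X \<in> VF M" "Y \<in> VF M" "Z \<in> VF M"
  shows "FT X (\<phi> Y) (\<phi> (\<phi> Z)) p = - FT X (\<phi> Z) (\<phi> (\<phi> Y)) p"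
  using F_Phi_skew[of X Y Z p] F_sym[of X "\<phi> (\<phi> Y)" "\<phi> Z" p] assms by simp

section \<open>The Nijenhuis tensors in terms of the fundamental tensor\<close>

text \<open>The expressions are formed for an arbitrary \<open>T\<close> in place of the fundamental tensor, so
  that they can be evaluated on the pieces of which the components \<open>F\<^sub>i\<close> are composed.\<close>

definition N1_of where "N1_of T X Y Z p =
  T (\<phi> X) Y Z p - T (\<phi> Y) X Z p + T Y X (\<phi> Z) p - T X Y (\<phi> Z) p
    + (T X (\<phi> Y) \<xi> p - T Y (\<phi> X) \<xi> p) * \<eta> Z p" for p :: 'a

definition N2_of where "N2_of T X Y p =
  T (\<phi> Y) (\<phi> X) \<xi> p - T (\<phi> X) (\<phi> Y) \<xi> p + T Y X \<xi> p - T X Y \<xi> p" for p :: 'a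

definition N3_of where "N3_of T X Y p = T \<xi> X Y p + T (\<phi> X) (\<phi> Y) \<xi> p - T X Y \<xi> p" for p :: 'a

definition N4_of where "N4_of T X p = - T \<xi> (\<phi> X) \<xi> p" for p :: 'a

text \<open>Smoothness of \<open>d\<eta>\<close> makes \<open>N\<^sup>(\<^sup>1\<^sup>)(X, Y)\<close> a smooth vector field, which its vanishing
  criterion \<open>VF_eq_0I\<close> requires.\<close>

lemma d_eta_smooth:
  assumes "X \<in> VF M" "Y \<in> VF M"
  shows "d_eta M D X Y \<in> smooth_functions (atlas M)"
proof -
  have "nabla_eta M D U V \<in> smooth_functions (atlas M)" if "U \<in> VF M" "V \<in> VF M" for U V
  proof -
    have "nabla_eta M D U V = g (D U \<xi>) V"
      using nabla_eta_eq[OF that] by auto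
    also have "\<dots> \<in> smooth_functions (atlas M)"
      using apapr that by (simp add: almost_paracontact_paracomplex_riemannian_def riemannian_metric_def)
    finally show ?thesis .
  qed
  note smooth = this
  have "d_eta M D X Y = (\<lambda>p. nabla_eta M D X Y p + (- 1) * nabla_eta M D Y X p)"
    by (auto simp: d_eta_def)
  then show ?thesis
    using assms smooth
    by (simp only:) (intro smooth_functions_add smooth_functions_mult smooth_functions_const atlas)
qed

lemma nijenhuis_VF: "X \<in> VF M \<Longrightarrow> Y \<in> VF M \<Longrightarrow> nijenhuis_phi M X Y \<in> VF M"
  by (simp add: nijenhuis_phi_def)

lemma N1_VF: "X \<in> VF M \<Longrightarrow> Y \<in> VF M \<Longrightarrow> N1 M D X Y \<in> VF M"
  by (simp add: N1_def nijenhuis_VF d_eta_smooth)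

lemma N3_VF: "X \<in> VF M \<Longrightarrow> N3 M X \<in> VF M"
  by (simp add: N3_def lie_phi_def)

text \<open>After replacing the brackets, the terms \<open>\<phi>\<^sup>2\<nabla>\<^sub>xy\<close> and \<open>\<phi>\<^sup>2\<nabla>\<^sub>yx\<close> combine with
  \<open>\<phi>\<nabla>\<^sub>x\<phi>y\<close> and \<open>\<phi>\<nabla>\<^sub>y\<phi>x\<close> to derivatives of \<open>\<phi>\<close>, and so do the terms differentiated along \<open>\<phi>x\<close>
  and \<open>\<phi>y\<close>.\<close>

lemma N1_F:
  assumes "X \<in> VF M" "Y \<in> VF M" "Z \<in> VF M"
  shows "g (N1 M D X Y) Z p = N1_of FT X Y Z p"
proof -
  have "g (N1 M D X Y) Z p = g (nijenhuis_phi M X Y) Z p - d_eta M D X Y p * \<eta> Z p"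
    using assms by (simp add: N1_def nijenhuis_VF d_eta_smooth G_diff_left G_fmult_left)
  also have "g (nijenhuis_phi M X Y) Z p
      = FT (\<phi> X) Y Z p - FT (\<phi> Y) X Z p + FT Y X (\<phi> Z) p - FT X Y (\<phi> Z) p"
    using assms
    by (simp add: nijenhuis_phi_def bracket F_eq G_diff_left G_diff_right G_add_left Phi_diff
        Phi_self_adjoint)
  finally show ?thesis
    using assms by (simp add: N1_of_def d_eta_def nabla_eta_F algebra_simps)
qed

lemma lie_eta_F:
  assumes "X \<in> VF M" "Y \<in> VF M"
  shows "lie_eta M X Y p = nabla_eta M D X Y p + \<eta> (D Y X) p"
  using assms by (simp add: lie_eta_def nabla_eta_def bracket Eta_diff)

lemma N2_F:
  assumes "X \<in> VF M" "Y \<in> VF M"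
  shows "N2 M X Y p = N2_of FT X Y p"
proof -
  have "\<eta> (D U (\<phi> V)) p = FT U V \<xi> p" if "U \<in> VF M" "V \<in> VF M" for U V
    using that by (simp add: F_eq)
  then show ?thesis
    using assms by (simp add: N2_def N2_of_def lie_eta_F nabla_eta_F)
qed

lemma N3_F:
  assumes "X \<in> VF M" "Y \<in> VF M"
  shows "g (N3 M X) Y p = N3_of FT X Y p"
proof -
  have "g (D U \<xi>) V p = - FT U (\<phi> V) \<xi> p" if "U \<in> VF M" "V \<in> VF M" for U V
    using that by (simp add: nabla_eta_F nabla_eta_eq[symmetric])
  then show ?thesis
    using assms
    by (simp add: N3_def N3_of_def lie_phi_def bracket F_eq[of \<xi> X Y] G_diff_left
        G_diff_right Phi_self_adjoint Phi_diff)
qed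

lemma N4_F:
  assumes "X \<in> VF M"
  shows "N4 M X p = N4_of FT X p"
proof -
  have "\<eta> (D X \<xi>) p = 0"
    using nabla_eta_F[of X \<xi> p] assms by (simp add: nabla_eta_eq)
  then show ?thesis
    using assms by (simp add: N4_def N4_of_def lie_eta_F nabla_eta_F)
qed

lemma N1_eq_0I:
  assumes "X \<in> VF M" "Y \<in> VF M" "\<And>Z p. Z \<in> VF M \<Longrightarrow> N1_of FT X Y Z p = 0"
  shows "N1 M D X Y = 0"
  using assms by (intro VF_eq_0I) (simp_all add: N1_F N1_VF)

lemma N2_eq_0I:
  assumes "X \<in> VF M" "Y \<in> VF M" "\<And>p. N2_of FT X Y p = 0"
  shows "N2 M X Y = 0"
  using assms by (simp add: fun_eq_iff N2_F)

lemma N3_eq_0I: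
  assumes "X \<in> VF M" "\<And>Z p. Z \<in> VF M \<Longrightarrow> N3_of FT X Z p = 0"
  shows "N3 M X = 0"
  using assms by (intro VF_eq_0I) (simp_all add: N3_F N3_VF)

lemma N4_eq_0I:
  assumes "X \<in> VF M" "\<And>p. N4_of FT X p = 0"
  shows "N4 M X = 0"
  using assms by (simp add: fun_eq_iff N4_F)

section \<open>The horizontal classes 1, 2, 3\<close>

text \<open>Up to the factor \<open>1 / (2n)\<close> this is \<open>F\<^sub>1\<close> with its Lee form replaced by an arbitrary
  function \<open>\<theta>\<close> of vector fields. The Nijenhuis expressions vanish on it by the shape of the
  formula and the symmetry of the bilinear forms \<open>g(x,\<phi>y)\<close> and \<open>g(x,\<phi>\<^sup>2y)\<close>.\<close>

definition F1_shape where "F1_shape \<theta> X Y Z p =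
  g (\<phi> X) (\<phi> Y) p * \<theta> (\<phi> (\<phi> Z)) p + g (\<phi> X) (\<phi> Z) p * \<theta> (\<phi> (\<phi> Y)) p
    - g X (\<phi> Y) p * \<theta> (\<phi> Z) p - g X (\<phi> Z) p * \<theta> (\<phi> Y) p" for p :: 'a

lemma N_of_F1_shape:
  assumes "X \<in> VF M" "Y \<in> VF M"
  shows "Z \<in> VF M \<Longrightarrow> N1_of (F1_shape \<theta>) X Y Z p = 0" "N2_of (F1_shape \<theta>) X Y p = 0"
    "N3_of (F1_shape \<theta>) X Y p = 0" "N4_of (F1_shape \<theta>) X p = 0"
  using assms G_sym[of Y "\<phi> X" p] G_sym[of Y "\<phi> (\<phi> X)" p]
  by (simp_all add: N1_of_def N2_of_def N3_of_def N4_of_def F1_shape_def Phi_self_adjoint algebra_simps)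

text \<open>The horizontal part \<open>H(x,y,z) = F(\<phi>\<^sup>2x,\<phi>\<^sup>2y,\<phi>\<^sup>2z)\<close> of \<open>F\<close> satisfies
  \<open>F\<^sub>1 + F\<^sub>2 = (2 H + F_mixed) / 4\<close> and \<open>F\<^sub>3 = (2 H - F_mixed) / 4\<close>. Thus \<open>F12\<close> below is \<open>4 (F\<^sub>1 + F\<^sub>2)\<close>.\<close>

definition F_mixed where "F_mixed X Y Z p =
   FT (\<phi> (\<phi> Y)) (\<phi> (\<phi> Z)) (\<phi> (\<phi> X)) p + FT (\<phi> (\<phi> Z)) (\<phi> (\<phi> X)) (\<phi> (\<phi> Y)) p
        - FT (\<phi> Y) (\<phi> Z) (\<phi> (\<phi> X)) p - FT (\<phi> Z) (\<phi> Y) (\<phi> (\<phi> X)) p"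

definition F12 where "F12 X Y Z p = 2 * FT (\<phi> (\<phi> X)) (\<phi> (\<phi> Y)) (\<phi> (\<phi> Z)) p + F_mixed X Y Z p"

text \<open>The contributions to \<open>N1_of F12\<close> cancel separately for each first argument of \<open>F\<close>, that is
  for each of the directions of differentiation \<open>\<phi>x\<close>, \<open>\<phi>y\<close>, \<open>\<phi>z\<close>, \<open>x\<close>, \<open>y\<close>, \<open>z\<close>, once \<open>\<phi>\<close> is moved between the other two arguments. The remaining expressions vanish because
  each of their terms contains \<open>\<phi> \<xi> = 0\<close>.\<close>

lemma N_of_F12:
  assumes "X \<in> VF M" "Y \<in> VF M"
  shows "Z \<in> VF M \<Longrightarrow> N1_of F12 X Y Z p = 0" "N2_of F12 X Y p = 0"
    "N3_of F12 X Y p = 0" "N4_of F12 X p = 0"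
proof -
  show "N1_of F12 X Y Z p = 0" if Z: "Z \<in> VF M"
  proof -
    note X = assms(1) and Y = assms(2)
    note 1 = X[THEN Phi_VF] Y[THEN Phi_VF] Z[THEN Phi_VF]
    note 2 = 1[THEN Phi_VF]
    note facts = F_sym[OF 1(1,2,3), of p] F_sym[OF 1(2,1,3), of p] F_sym[OF 1(3,1,2), of p]
      F_Phi_PhiPhi_alt[OF 2(1) Y Z, of p] F_Phi_PhiPhi_alt[OF 2(2) X Z, of p]
      F_Phi_PhiPhi_alt[OF 2(3) X Y, of p]
    show ?thesis
      using X Y Z
      by (simp add: N1_of_def F12_def F_mixed_def F_PhiPhi_PhiPhi F_Phi_skew) (use facts in linarith)
  qed
qed (use assms in \<open>simp_all add: N2_of_def N3_of_def N4_of_def F12_def F_mixed_def\<close>)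

lemma N_of_linear:
  assumes "\<And>X Y Z. X \<in> VF M \<Longrightarrow> Y \<in> VF M \<Longrightarrow> Z \<in> VF M
      \<Longrightarrow> T X Y Z p = a * T1 X Y Z p + b * T2 X Y Z p"
    and "X \<in> VF M" "Y \<in> VF M"
  shows "Z \<in> VF M \<Longrightarrow> N1_of T X Y Z p = a * N1_of T1 X Y Z p + b * N1_of T2 X Y Z p"
    and "N2_of T X Y p = a * N2_of T1 X Y p + b * N2_of T2 X Y p"
    and "N3_of T X Y p = a * N3_of T1 X Y p + b * N3_of T2 X Y p"
    and "N4_of T X p = a * N4_of T1 X p + b * N4_of T2 X p"
  using assms by (simp_all add: N1_of_def N2_of_def N3_of_def N4_of_def algebra_simps)

lemma basic_classD:
  "basic_class i n M D \<Longrightarrow> X \<in> VF M \<Longrightarrow> Y \<in> VF M \<Longrightarrow> Z \<in> VF M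
    \<Longrightarrow> FT X Y Z p = F_component i n M D X Y Z p"
  by (simp add: basic_class_def)

lemma N_of_F1:
  assumes "basic_class 1 n M D" "X \<in> VF M" "Y \<in> VF M"
  shows "Z \<in> VF M \<Longrightarrow> N1_of FT X Y Z p = 0"
    "N2_of FT X Y p = 0" "N3_of FT X Y p = 0" "N4_of FT X p = 0"
proof -
  have "FT X Y Z p = 1 / (2 * real n) * F1_shape (theta n M D) X Y Z p
      + 0 * F1_shape (theta n M D) X Y Z p"
    if "X \<in> VF M" "Y \<in> VF M" "Z \<in> VF M" for X Y Z
    using basic_classD[OF assms(1) that]
    by (simp add: F_component_def F1_def F1_shape_def Let_def)
  note * = N_of_linear[of FT p "1 / (2 * real n)" "F1_shape (theta n M D)" 0 "F1_shape (theta n M D)",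
      OF this assms(2,3)]
  show "Z \<in> VF M \<Longrightarrow> N1_of FT X Y Z p = 0"
    "N2_of FT X Y p = 0" "N3_of FT X Y p = 0" "N4_of FT X p = 0"
    using assms by (simp_all add: * N_of_F1_shape)
qed

lemma N_of_F2:
  assumes "basic_class 2 n M D" "X \<in> VF M" "Y \<in> VF M"
  shows "Z \<in> VF M \<Longrightarrow> N1_of FT X Y Z p = 0"
    "N2_of FT X Y p = 0" "N3_of FT X Y p = 0" "N4_of FT X p = 0"
proof -
  have "FT X Y Z p = 1 / 4 * F12 X Y Z p + (- 1 / (2 * real n)) * F1_shape (theta n M D) X Y Z p"
    if "X \<in> VF M" "Y \<in> VF M" "Z \<in> VF M" for X Y Z
    using basic_classD[OF assms(1) that]
    by (simp add: F_component_def F1_def F2_def F1_shape_def F12_def F_mixed_def Let_def)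
  note * = N_of_linear[of FT p "1 / 4" F12 "- 1 / (2 * real n)" "F1_shape (theta n M D)",
      OF this assms(2,3)]
  show "Z \<in> VF M \<Longrightarrow> N1_of FT X Y Z p = 0"
    "N2_of FT X Y p = 0" "N3_of FT X Y p = 0" "N4_of FT X p = 0"
    using assms by (simp_all add: * N_of_F1_shape N_of_F12)
qed

text \<open>In the cyclic sum of \<open>F\<^sub>3\<close> the terms \<open>2 H\<close> cancel against the purely horizontal terms of
  \<open>F_mixed\<close>. The others pair up as \<open>F(\<phi>y,\<phi>z,x) + F(\<phi>y,\<phi>x,z) = 0\<close> on horizontal arguments.\<close>

lemma cyclic_sum_F3_manifold:
  assumes "basic_class 3 n M D" "X \<in> VF M" "Y \<in> VF M" "Z \<in> VF M"
  shows "FT (\<phi> (\<phi> X)) (\<phi> (\<phi> Y)) (\<phi> (\<phi> Z)) p + FT (\<phi> (\<phi> Y)) (\<phi> (\<phi> Z)) (\<phi> (\<phi> X)) p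
    + FT (\<phi> (\<phi> Z)) (\<phi> (\<phi> X)) (\<phi> (\<phi> Y)) p = 0"
proof -
  let ?h = "\<lambda>V. \<phi> (\<phi> V)"
  have *: "4 * FT (?h U) (?h V) (?h W) p = 2 * FT (?h U) (?h V) (?h W) p - F_mixed U V W p"
    if "U \<in> VF M" "V \<in> VF M" "W \<in> VF M" for U V W
    using basic_classD[OF assms(1), of "?h U" "?h V" "?h W" p] that
    by (simp add: F_component_def F3_def F_mixed_def Let_def)
  note X = assms(2) and Y = assms(3) and Z = assms(4)
  show ?thesis
    using *[OF X Y Z] *[OF Y Z X] *[OF Z X Y]
      F_Phi_PhiPhi_alt[OF Phi_VF[OF X] Y Z, of p] F_Phi_PhiPhi_alt[OF Phi_VF[OF Y] Z X, of p]
      F_Phi_PhiPhi_alt[OF Phi_VF[OF Z] X Y, of p]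
    unfolding F_mixed_def by linarith
qed

text \<open>Since \<open>F = H - F12 / 4\<close> and \<open>N1_of\<close> vanishes on \<open>F12\<close>, the value of \<open>N1_of\<close> at \<open>F\<close> is the
  one at \<open>H\<close>. It consists of four terms, and adding the cyclic identities for
  \<open>(\<phi>x, y, z)\<close> and \<open>(\<phi>y, x, z)\<close> replaces the two terms with direction \<open>y\<close> or \<open>\<phi>y\<close> by those with
  direction \<open>x\<close> or \<open>\<phi>x\<close>. This is the origin of the factor 2.\<close>

lemma N_of_F3:
  assumes "basic_class 3 n M D" "X \<in> VF M" "Y \<in> VF M"
  shows "Z \<in> VF M \<Longrightarrow> N1_of FT X Y Z p
      = - 2 * (FT (\<phi> X) (\<phi> Y) (\<phi> Z) p + FT (\<phi> (\<phi> X)) (\<phi> (\<phi> Y)) (\<phi> Z) p)"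
    "N2_of FT X Y p = 0" "N3_of FT X Y p = 0" "N4_of FT X p = 0"
proof -
  define H where "H X Y Z p = FT (\<phi> (\<phi> X)) (\<phi> (\<phi> Y)) (\<phi> (\<phi> Z)) p" for X Y Z p
  have "FT X Y Z p = 1 * H X Y Z p + (- 1 / 4) * F12 X Y Z p"
    if "X \<in> VF M" "Y \<in> VF M" "Z \<in> VF M" for X Y Z
    using basic_classD[OF assms(1) that, of p]
    by (simp add: F_component_def F3_def H_def F12_def F_mixed_def Let_def field_simps)
  note * = N_of_linear[of FT p 1 H "- 1 / 4" F12,
      OF this assms(2,3)]
  have "N2_of H X Y p = 0" "N3_of H X Y p = 0" "N4_of H X p = 0"
    using assms by (simp_all add: H_def N2_of_def N3_of_def N4_of_def)
  then show "N2_of FT X Y p = 0" "N3_of FT X Y p = 0" "N4_of FT X p = 0"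
    using assms by (simp_all add: * N_of_F12)
  show "N1_of FT X Y Z p
      = - 2 * (FT (\<phi> X) (\<phi> Y) (\<phi> Z) p + FT (\<phi> (\<phi> X)) (\<phi> (\<phi> Y)) (\<phi> Z) p)" if Z: "Z \<in> VF M"
  proof -
    note X = assms(2) and Y = assms(3)
    note 1 = X[THEN Phi_VF] Y[THEN Phi_VF] Z[THEN Phi_VF]
    note 2 = 1[THEN Phi_VF]
    have cyclic: "FT (\<phi> U) (\<phi> V) (\<phi> W) p + FT (\<phi> (\<phi> V)) (\<phi> W) (\<phi> (\<phi> U)) p
        = FT (\<phi> (\<phi> W)) (\<phi> U) (\<phi> (\<phi> V)) p" if "U \<in> VF M" "V \<in> VF M" "W \<in> VF M" for U V W
      using cyclic_sum_F3_manifold[OF assms(1), of "\<phi> U" V W p] that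
      by (simp add: F_PhiPhi_PhiPhi F_Phi_skew)
    have exchange: "FT (\<phi> X) (\<phi> Y) (\<phi> Z) p + FT (\<phi> Y) (\<phi> X) (\<phi> Z) p
        = FT (\<phi> (\<phi> X)) (\<phi> Y) (\<phi> (\<phi> Z)) p + FT (\<phi> (\<phi> Y)) (\<phi> X) (\<phi> (\<phi> Z)) p"
      using cyclic[OF X Y Z] cyclic[OF Y X Z] F_Phi_PhiPhi_alt[OF 2(1) Y Z, of p]
        F_Phi_PhiPhi_alt[OF 2(2) X Z, of p] F_Phi_PhiPhi_alt[OF 2(3) X Y, of p]
      by linarith
    have "N1_of FT X Y Z p = N1_of H X Y Z p"
      using X Y Z by (simp add: * N_of_F12)
    also have "\<dots> = - FT (\<phi> X) (\<phi> Y) (\<phi> Z) p + FT (\<phi> Y) (\<phi> X) (\<phi> Z) p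
        - FT (\<phi> (\<phi> Y)) (\<phi> X) (\<phi> (\<phi> Z)) p + FT (\<phi> (\<phi> X)) (\<phi> Y) (\<phi> (\<phi> Z)) p"
      using X Y Z by (simp add: N1_of_def H_def F_PhiPhi_PhiPhi F_Phi_skew)
    also have "\<dots> = - 2 * (FT (\<phi> X) (\<phi> Y) (\<phi> Z) p - FT (\<phi> (\<phi> X)) (\<phi> Y) (\<phi> (\<phi> Z)) p)"
      using exchange by (simp add: algebra_simps)
    finally show ?thesis
      using X Y Z by (simp add: F_Phi_skew)
  qed
qed

section \<open>The mixed classes 4 to 9\<close>

text \<open>Here \<open>S(x,y) = F(x,y,\<xi>)\<close>, hence \<open>S(\<phi>x,y) = s S(x,\<phi>y)\<close> because \<open>F(x,\<phi>\<^sup>2y,\<xi>) = F(x,y,\<xi>)\<close>.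
  This relation and the swapping rule reduce the coefficient of \<open>\<eta>(z)\<close> in \<open>N1_of F\<close> to a multiple
  of \<open>S(x,\<phi>y)\<close>. The factor \<open>(1 + s) (1 - s t)\<close> is nonzero for \<open>s = 1\<close>, \<open>t = -1\<close> only, which is
  class 7, whereas \<open>s - 1\<close> is nonzero for the classes 8 and 9.\<close>

lemma N_of_mixed:
  assumes F: "\<And>X Y Z. X \<in> VF M \<Longrightarrow> Y \<in> VF M \<Longrightarrow> Z \<in> VF M
      \<Longrightarrow> FT X Y Z p = S X Y p * \<eta> Z p + S X Z p * \<eta> Y p"
    and S_xi: "\<And>X. X \<in> VF M \<Longrightarrow> S X \<xi> p = 0"
    and S_Phi: "\<And>X Y. X \<in> VF M \<Longrightarrow> Y \<in> VF M \<Longrightarrow> S (\<phi> X) (\<phi> Y) p = s * S X Y p"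
    and S_swap: "\<And>X Y. X \<in> VF M \<Longrightarrow> Y \<in> VF M \<Longrightarrow> S Y X p = t * S X Y p"
    and X: "X \<in> VF M" and Y: "Y \<in> VF M"
  shows "Z \<in> VF M \<Longrightarrow> N1_of FT X Y Z p = (1 + s) * (1 - s * t) * (FT X (\<phi> Y) \<xi> p * \<eta> Z p)
      + (s - 1) * (\<eta> Y p * FT X (\<phi> Z) \<xi> p - \<eta> X p * FT Y (\<phi> Z) \<xi> p)"
    and "N2_of FT X Y p = (1 + s) * (t - 1) * FT X Y \<xi> p"
    and "N3_of FT X Y p = (s - 1) * FT X Y \<xi> p"
    and "N4_of FT X p = 0"
proof -
  have S: "S U V p = FT U V \<xi> p" if "U \<in> VF M" "V \<in> VF M" for U V
    using F[of U V \<xi>] that by (simp add: S_xi)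
  have left: "S (\<phi> U) V p = s * S U (\<phi> V) p" if "U \<in> VF M" "V \<in> VF M" for U V
    using S_Phi[of U "\<phi> V"] that by (simp add: S)
  have xi: "S \<xi> U p = 0" if "U \<in> VF M" for U
    using S_swap[of U \<xi>] that by (simp add: S_xi)
  have swap: "S Y (\<phi> X) p = t * s * S X (\<phi> Y) p"
    using S_swap[of "\<phi> X" Y] X Y by (simp add: left)
  show "N1_of FT X Y Z p = (1 + s) * (1 - s * t) * (FT X (\<phi> Y) \<xi> p * \<eta> Z p)
      + (s - 1) * (\<eta> Y p * FT X (\<phi> Z) \<xi> p - \<eta> X p * FT Y (\<phi> Z) \<xi> p)" if "Z \<in> VF M"
    using X Y that by (simp add: N1_of_def F S_xi left swap algebra_simps)
  show "N2_of FT X Y p = (1 + s) * (t - 1) * FT X Y \<xi> p"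
    using X Y S_swap[of X Y] S_swap[of "\<phi> X" "\<phi> Y"]
    by (simp add: N2_of_def F S_xi S_Phi algebra_simps)
  show "N3_of FT X Y p = (s - 1) * FT X Y \<xi> p" "N4_of FT X p = 0"
    using X Y by (simp_all add: N3_of_def N4_of_def F S_xi S_Phi xi algebra_simps)
qed

text \<open>The three components differ only in the bilinear form \<open>S\<close>. Each of the forms is symmetric
  and invariant under \<open>\<phi>\<close>, so \<open>s = t = 1\<close>, and for these signs all coefficients vanish.\<close>

lemma N_of_F4_to_F6:
  assumes "basic_class i n M D" "i \<in> {4, 5, 6}" "X \<in> VF M" "Y \<in> VF M"
  shows "Z \<in> VF M \<Longrightarrow> N1_of FT X Y Z p = 0"
    "N2_of FT X Y p = 0" "N3_of FT X Y p = 0" "N4_of FT X p = 0"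
proof -
  define a where "a = theta n M D \<xi> p / (2 * real n)"
  define b where "b = theta_star n M D \<xi> p / (2 * real n)"
  define S4 S5 S6 where "S4 U V q = a * g (\<phi> U) (\<phi> V) q" and "S5 U V q = b * g U (\<phi> V) q"
    and "S6 U V q = 1 / 4 * (bF M D U V q + bF M D V U q + cF M D U V q + cF M D V U q)
      - S4 U V q - S5 U V q" for U V and q :: 'a
  note defs = S4_def S5_def S6_def bF_def cF_def
  define S where "S = (if i = 4 then S4 else if i = 5 then S5 else S6)"
  have F: "FT X Y Z p = S X Y p * \<eta> Z p + S X Z p * \<eta> Y p"
    if "X \<in> VF M" "Y \<in> VF M" "Z \<in> VF M" for X Y Z
    using basic_classD[OF assms(1) that, of p] assms(2)
    by (auto simp: F_component_def F4_def F5_def F6_def eta_sym_def Let_def S_def defs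
        a_def b_def algebra_simps)
  have xi: "S X \<xi> p = 0" if "X \<in> VF M" for X
    using that by (simp add: S_def defs)
  have Phi: "S (\<phi> X) (\<phi> Y) p = 1 * S X Y p" if "X \<in> VF M" "Y \<in> VF M" for X Y
    using that by (simp add: S_def defs Phi_self_adjoint)
  have swap: "S Y X p = 1 * S X Y p" if "X \<in> VF M" "Y \<in> VF M" for X Y
    using that G_sym[of Y "\<phi> X" p] G_sym[of Y "\<phi> (\<phi> X)" p]
    by (simp add: S_def defs Phi_self_adjoint)
  note V = N_of_mixed[of p S 1 1, OF F xi Phi swap assms(3,4)]
  show "Z \<in> VF M \<Longrightarrow> N1_of FT X Y Z p = 0"
    "N2_of FT X Y p = 0" "N3_of FT X Y p = 0" "N4_of FT X p = 0"
    by (simp_all add: V)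
qed

text \<open>The components 7, 8, 9 are the parts of \<open>b\<close> on which the involutions
  \<open>S \<mapsto> S(\<phi>\<cdot>,\<phi>\<cdot>)\<close> and transposition act by the signs \<open>s\<close> and \<open>t\<close>; the former exchanges
  \<open>b\<close> and \<open>c\<close>.\<close>

lemma N_of_F7_to_F9:
  assumes "basic_class i n M D" "(i, s, t) \<in> {(7, 1, - 1), (8, - 1, 1), (9, - 1, - 1)}"
    "X \<in> VF M" "Y \<in> VF M"
  shows "Z \<in> VF M \<Longrightarrow> N1_of FT X Y Z p = (1 + s) * (1 - s * t) * (FT X (\<phi> Y) \<xi> p * \<eta> Z p)
      + (s - 1) * (\<eta> Y p * FT X (\<phi> Z) \<xi> p - \<eta> X p * FT Y (\<phi> Z) \<xi> p)"
    and "N2_of FT X Y p = (1 + s) * (t - 1) * FT X Y \<xi> p"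
    and "N3_of FT X Y p = (s - 1) * FT X Y \<xi> p"
    and "N4_of FT X p = 0"
proof -
  define S where "S U V q = 1 / 4 * (bF M D U V q + t * bF M D V U q
      + s * (cF M D U V q + t * cF M D V U q))" for U V and q :: 'a
  have F: "FT X Y Z p = S X Y p * \<eta> Z p + S X Z p * \<eta> Y p"
    if "X \<in> VF M" "Y \<in> VF M" "Z \<in> VF M" for X Y Z
    using basic_classD[OF assms(1) that, of p] assms(2)
    by (auto simp: F_component_def F7_def F8_def F9_def eta_sym_def Let_def S_def algebra_simps)
  have xi: "S X \<xi> p = 0" if "X \<in> VF M" for X
    using that by (simp add: S_def bF_def cF_def)
  have Phi: "S (\<phi> X) (\<phi> Y) p = s * S X Y p" if "X \<in> VF M" "Y \<in> VF M" for X Y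
    using that assms(2) by (auto simp: S_def bF_def cF_def)
  have swap: "S Y X p = t * S X Y p" if "X \<in> VF M" "Y \<in> VF M" for X Y
    using assms(2) by (auto simp: S_def)
  note V = N_of_mixed[of p S s t, OF F xi Phi swap assms(3,4)]
  show "Z \<in> VF M \<Longrightarrow> N1_of FT X Y Z p = (1 + s) * (1 - s * t) * (FT X (\<phi> Y) \<xi> p * \<eta> Z p)
      + (s - 1) * (\<eta> Y p * FT X (\<phi> Z) \<xi> p - \<eta> X p * FT Y (\<phi> Z) \<xi> p)"
    "N2_of FT X Y p = (1 + s) * (t - 1) * FT X Y \<xi> p"
    "N3_of FT X Y p = (s - 1) * FT X Y \<xi> p" "N4_of FT X p = 0"
    by (rule V; assumption)+
qed

section \<open>The vertical classes 10 and 11\<close>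

lemma N_of_F10:
  assumes "basic_class 10 n M D" "X \<in> VF M" "Y \<in> VF M"
  shows "Z \<in> VF M \<Longrightarrow> N1_of FT X Y Z p = - \<eta> X p * FT \<xi> Y (\<phi> Z) p + \<eta> Y p * FT \<xi> X (\<phi> Z) p"
    "N2_of FT X Y p = 0" "N3_of FT X Y p = FT \<xi> X Y p" "N4_of FT X p = 0"
proof -
  have F: "FT U V W p = \<eta> U p * FT \<xi> V W p" if "U \<in> VF M" "V \<in> VF M" "W \<in> VF M" for U V W
    using basic_classD[OF assms(1), of U V W p] basic_classD[OF assms(1), of \<xi> V W p] that
    by (simp add: F_component_def F10_def)
  have xi: "FT \<xi> V \<xi> p = 0" if "V \<in> VF M" for V
    using basic_classD[OF assms(1), of \<xi> V \<xi> p] that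
    by (simp add: F_component_def F10_def)
  show "N1_of FT X Y Z p = - \<eta> X p * FT \<xi> Y (\<phi> Z) p + \<eta> Y p * FT \<xi> X (\<phi> Z) p" if "Z \<in> VF M"
    using that assms F[of X] F[of Y] F[of "\<phi> X"] F[of "\<phi> Y"] by (simp add: N1_of_def xi)
  show "N2_of FT X Y p = 0" "N3_of FT X Y p = FT \<xi> X Y p" "N4_of FT X p = 0"
    using assms F[of X] F[of Y] F[of "\<phi> X"] F[of "\<phi> Y"] by (simp_all add: N2_of_def N3_of_def N4_of_def xi)
qed

lemma N_of_F11:
  assumes "basic_class 11 n M D" "X \<in> VF M" "Y \<in> VF M"
  shows "Z \<in> VF M \<Longrightarrow> N1_of FT X Y Z p
      = \<eta> Z p * (\<eta> X p * omega M D (\<phi> Y) p - \<eta> Y p * omega M D (\<phi> X) p)"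
    "N2_of FT X Y p = \<eta> Y p * omega M D X p - \<eta> X p * omega M D Y p"
    "N3_of FT X Y p = \<eta> Y p * omega M D X p" "N4_of FT X p = - omega M D (\<phi> X) p"
proof -
  have F: "FT U V W p = \<eta> U p * (\<eta> V p * omega M D W p + \<eta> W p * omega M D V p)"
    if "U \<in> VF M" "V \<in> VF M" "W \<in> VF M" for U V W
    using basic_classD[OF assms(1), of U V W p] that by (simp add: F_component_def F11_def)
  have xi: "omega M D \<xi> p = 0"
    by (simp add: omega_def)
  show "N1_of FT X Y Z p
      = \<eta> Z p * (\<eta> X p * omega M D (\<phi> Y) p - \<eta> Y p * omega M D (\<phi> X) p)" if "Z \<in> VF M"
    using that assms by (simp add: N1_of_def F xi algebra_simps)
  show "N2_of FT X Y p = \<eta> Y p * omega M D X p - \<eta> X p * omega M D Y p"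
    "N3_of FT X Y p = \<eta> Y p * omega M D X p" "N4_of FT X p = - omega M D (\<phi> X) p"
    using assms by (simp_all add: N2_of_def N3_of_def N4_of_def F xi algebra_simps)
qed

end
section \<open>The Nijenhuis tensors of the basic classes\<close>

theorem proposition5p2:
  fixes M :: "('a::{t2_space, second_countable_topology}, 'e::euclidean_space) apapr"
    and D :: "'a connection" and n i :: nat
    and X Y Z :: "'a vfield" and p :: 'a
  assumes "almost_paracontact_paracomplex_riemannian n M"
    and "levi_civita M D"
    and "i \<in> {1..11}"
    and "basic_class i n M D"
    and "X \<in> VF M" and "Y \<in> VF M" and "Z \<in> VF M"
  shows
    "(i \<in> {1, 2, 4, 5, 6} \<longrightarrow>
        N1 M D X Y = 0 \<and> N2 M X Y = 0 \<and> N3 M X = 0 \<and> N4 M X = 0) \<and>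
     (i = 3 \<longrightarrow>
        G M (N1 M D X Y) Z p =
          - 2 * (F M D (Phi M X) (Phi M Y) (Phi M Z) p
                 + F M D (Phi M (Phi M X)) (Phi M (Phi M Y)) (Phi M Z) p) \<and>
        N2 M X Y = 0 \<and> N3 M X = 0 \<and> N4 M X = 0) \<and>
     (i = 7 \<longrightarrow>
        G M (N1 M D X Y) Z p = 4 * F M D X (Phi M Y) (xi M) p * Eta M Z p \<and>
        N2 M X Y p = - 4 * F M D X Y (xi M) p \<and>
        N3 M X = 0 \<and> N4 M X = 0) \<and>
     (i \<in> {8, 9} \<longrightarrow>
        G M (N1 M D X Y) Z p =
          2 * (Eta M X p * F M D Y (Phi M Z) (xi M) p
               - Eta M Y p * F M D X (Phi M Z) (xi M) p) \<and>
        N2 M X Y = 0 \<and>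
        G M (N3 M X) Y p = - 2 * F M D X Y (xi M) p \<and>
        N4 M X = 0) \<and>
     (i = 10 \<longrightarrow>
        G M (N1 M D X Y) Z p =
          - Eta M X p * F M D (xi M) Y (Phi M Z) p
          + Eta M Y p * F M D (xi M) X (Phi M Z) p \<and>
        N2 M X Y = 0 \<and>
        G M (N3 M X) Y p = F M D (xi M) X Y p \<and>
        N4 M X = 0) \<and>
     (i = 11 \<longrightarrow>
        G M (N1 M D X Y) Z p =
          Eta M Z p * (Eta M X p * omega M D (Phi M Y) p - Eta M Y p * omega M D (Phi M X) p) \<and>
        N2 M X Y p = Eta M Y p * omega M D X p - Eta M X p * omega M D Y p \<and>
        G M (N3 M X) Y p = Eta M Y p * omega M D X p \<and>
        N4 M X p = - omega M D (Phi M X) p)"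
proof -
  interpret apapr_levi_civita n M D
    using assms by unfold_locales
  note XYZ = assms(5-7)
  note zeroI = N1_eq_0I N2_eq_0I N3_eq_0I N4_eq_0I
  note N_F = N1_F N2_F N3_F N4_F
  have "N1 M D X Y = 0 \<and> N2 M X Y = 0 \<and> N3 M X = 0 \<and> N4 M X = 0" if "i = 1"
    using N_of_F1 that assms(4) XYZ by (simp add: zeroI)
  moreover have "N1 M D X Y = 0 \<and> N2 M X Y = 0 \<and> N3 M X = 0 \<and> N4 M X = 0" if "i = 2"
    using N_of_F2 that assms(4) XYZ by (simp add: zeroI)
  moreover have "N1 M D X Y = 0 \<and> N2 M X Y = 0 \<and> N3 M X = 0 \<and> N4 M X = 0" if "i \<in> {4, 5, 6}"
    using N_of_F4_to_F6[OF assms(4) that] XYZ by (simp add: zeroI)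
  moreover have "G M (N1 M D X Y) Z p =
          - 2 * (F M D (Phi M X) (Phi M Y) (Phi M Z) p
                 + F M D (Phi M (Phi M X)) (Phi M (Phi M Y)) (Phi M Z) p) \<and>
        N2 M X Y = 0 \<and> N3 M X = 0 \<and> N4 M X = 0" if "i = 3"
    using N_of_F3 that assms(4) XYZ by (simp add: zeroI N1_F)
  moreover have "G M (N1 M D X Y) Z p = 4 * F M D X (Phi M Y) (xi M) p * Eta M Z p \<and>
        N2 M X Y p = - 4 * F M D X Y (xi M) p \<and>
        N3 M X = 0 \<and> N4 M X = 0" if "i = 7"
    using N_of_F7_to_F9[of 7 1 "- 1"] that assms(4) XYZ by (simp add: zeroI N_F)
  moreover have "G M (N1 M D X Y) Z p =
          2 * (Eta M X p * F M D Y (Phi M Z) (xi M) p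
               - Eta M Y p * F M D X (Phi M Z) (xi M) p) \<and>
        N2 M X Y = 0 \<and>
        G M (N3 M X) Y p = - 2 * F M D X Y (xi M) p \<and>
        N4 M X = 0" if "i \<in> {8, 9}"
    using N_of_F7_to_F9[of i "- 1" "if i = 8 then 1 else - 1"] that assms(4) XYZ
    by (auto simp add: zeroI N_F)
  ultimately show ?thesis
    using N_of_F10[of X Y] N_of_F11[of X Y] assms(4) XYZ by (auto simp: zeroI N_F)
qed

end
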